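(* Let $N$ be a positive integer and let $w \in F_N$. Then $w \in \bar{\mathcal{A}}$ if and only if $w$ can be written as \[ w = p_1\delta_1p_2\delta_2\cdots p_n\delta_np_{n+1} \] for some $n \geq 0$ with $p_1, \ldots, p_{n+1} \in \mathcal{P}$ and $\delta_1, \ldots, \delta_n \in \mathbb{Z}/N\mathbb{Z}$. Moreover, such a factorization of $w \in \bar{\mathcal{A}}$ is unique.
   Context: $N$ is a positive integer. $F_N$ is the free monoid of all finite words with letters in $\mathbb{Z}/N\mathbb{Z}$ (identity: the empty word $\varepsilon$); juxtaposition of letters and words is concatenation. $\pi : F_N \to \mathrm{SL}_2(\mathbb{Z}/N\mathbb{Z})$ is the monoid homomorphism with $\pi(\alpha) = \begin{bmatrix} 0 & 1 \\ -1 & \alpha \end{bmatrix}$ for each letter $\alpha$, so $\pi(\alpha_1\cdots\alpha_l)=\pi(\alpha_1)\cdots\pi(\alpha_l)$ and $\pi(\varepsilon)$ is the identity matrix. On $(\mathbb{Z}/N\mathbb{Z})^2\smallsetminus\{0\}$ (column vectors) let $u\sim' v$ if and only if $u=\lambda v$ for some $\lambda\in(\mathbb{Z}/N\mathbb{Z})^\times$, the unit group of $\mathbb{Z}/N\mathbb{Z}$; $\mathrm{SL}_2(\mathbb{Z}/N\mathbb{Z})$ acts on the set of $\sim'$-classes by left multiplication. $\bar{\mathcal{A}} = \left\{w \in F_N : \pi(w)\begin{bmatrix} 0 \\ 1 \end{bmatrix} = \begin{bmatrix} 1 \\ 0 \end{bmatrix}\right\}$, where the equality is one of $\sim'$-classes,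 and $\bar{\mathcal{C}}=F_N\smallsetminus\bar{\mathcal{A}}$. $F_N^l$ is the set of words of length $l$, $\bar{\mathcal{A}}^l=F_N^l\cap\bar{\mathcal{A}}$ and $\bar{\mathcal{C}}^l=F_N^l\cap\bar{\mathcal{C}}$. Let $\mathcal{P}^l = \left\{ \alpha_1 \alpha_2 \cdots \alpha_l \in \bar{\mathcal{A}}^l : \alpha_1 \cdots \alpha_h \in \bar{\mathcal{C}}^h \text{ for } h=1, \ldots , l-1 \right\}$ and $\mathcal{P}=\bigcup_l \mathcal{P}^l$. *)

theory Defs
  imports "HOL-Algebra.Algebra"
begin

text \<open>
  The definitions are stated over an arbitrary commutative ring \<open>R\<close>; the ring
  \<open>\<int>/N\<int>\<close> is \<^term>\<open>ZFact (int N)\<close>.  Words are lists, a column vector with entries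
  \<open>x, y\<close> is the pair \<open>(x, y)\<close>, and a \<open>2 \<times> 2\<close> matrix is the pair of its rows.
\<close>

type_synonym 'a vec2 = "'a \<times> 'a"
type_synonym 'a mat2 = "('a \<times> 'a) \<times> ('a \<times> 'a)"

fun mat2_mult :: "('a, 'm) ring_scheme \<Rightarrow> 'a mat2 \<Rightarrow> 'a mat2 \<Rightarrow> 'a mat2" where
  "mat2_mult R ((a, b), (c, d)) ((a', b'), (c', d')) =
     ((a \<otimes>\<^bsub>R\<^esub> a' \<oplus>\<^bsub>R\<^esub> b \<otimes>\<^bsub>R\<^esub> c', a \<otimes>\<^bsub>R\<^esub> b' \<oplus>\<^bsub>R\<^esub> b \<otimes>\<^bsub>R\<^esub> d'),
      (c \<otimes>\<^bsub>R\<^esub> a' \<oplus>\<^bsub>R\<^esub> d \<otimes>\<^bsub>R\<^esub> c', c \<otimes>\<^bsub>R\<^esub> b' \<oplus>\<^bsub>R\<^esub> d \<otimes>\<^bsub>R\<^esub> d'))"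

fun mat2_vec :: "('a, 'm) ring_scheme \<Rightarrow> 'a mat2 \<Rightarrow> 'a vec2 \<Rightarrow> 'a vec2" where
  "mat2_vec R ((a, b), (c, d)) (x, y) =
     (a \<otimes>\<^bsub>R\<^esub> x \<oplus>\<^bsub>R\<^esub> b \<otimes>\<^bsub>R\<^esub> y, c \<otimes>\<^bsub>R\<^esub> x \<oplus>\<^bsub>R\<^esub> d \<otimes>\<^bsub>R\<^esub> y)"

definition SL2 :: "('a, 'm) ring_scheme \<Rightarrow> 'a mat2 monoid" where
  "SL2 R = \<lparr>carrier = {((a, b), (c, d)) | a b c d.
       a \<in> carrier R \<and> b \<in> carrier R \<and> c \<in> carrier R \<and> d \<in> carrier R \<and>
       a \<otimes>\<^bsub>R\<^esub> d \<ominus>\<^bsub>R\<^esub> b \<otimes>\<^bsub>R\<^esub> c = \<one>\<^bsub>R\<^esub>},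
     monoid.mult = mat2_mult R,
     one = ((\<one>\<^bsub>R\<^esub>, \<zero>\<^bsub>R\<^esub>), (\<zero>\<^bsub>R\<^esub>, \<one>\<^bsub>R\<^esub>))\<rparr>"

definition words :: "('a, 'm) ring_scheme \<Rightarrow> 'a list set" where
  "words R = lists (carrier R)"

definition letter_mat :: "('a, 'm) ring_scheme \<Rightarrow> 'a \<Rightarrow> 'a mat2" where
  "letter_mat R \<alpha> = ((\<zero>\<^bsub>R\<^esub>, \<one>\<^bsub>R\<^esub>), (\<ominus>\<^bsub>R\<^esub> \<one>\<^bsub>R\<^esub>, \<alpha>))"

primrec word_mat :: "('a, 'm) ring_scheme \<Rightarrow> 'a list \<Rightarrow> 'a mat2" where
  "word_mat R [] = \<one>\<^bsub>SL2 R\<^esub>"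
| "word_mat R (\<alpha> # w) = letter_mat R \<alpha> \<otimes>\<^bsub>SL2 R\<^esub> word_mat R w"

definition nonzero_vecs :: "('a, 'm) ring_scheme \<Rightarrow> 'a vec2 set" where
  "nonzero_vecs R = carrier R \<times> carrier R - {(\<zero>\<^bsub>R\<^esub>, \<zero>\<^bsub>R\<^esub>)}"

text \<open>
  The relation \<open>\<sim>'\<close> lives on nonzero vectors only.  For \<open>N = 1\<close> there are no nonzero
  vectors, so no two vectors are related.
\<close>

definition unit_rel :: "('a, 'm) ring_scheme \<Rightarrow> 'a vec2 rel" where
  "unit_rel R = {(u, v). u \<in> nonzero_vecs R \<and> v \<in> nonzero_vecs R \<and>
     (\<exists>r\<in>Units R. u = (r \<otimes>\<^bsub>R\<^esub> fst v, r \<otimes>\<^bsub>R\<^esub> snd v))}"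

text \<open>Equality of \<open>\<sim>'\<close>-classes is expressed as being related by \<open>\<sim>'\<close>.\<close>

definition A_bar :: "('a, 'm) ring_scheme \<Rightarrow> 'a list set" where
  "A_bar R = {w \<in> words R.
     (mat2_vec R (word_mat R w) (\<zero>\<^bsub>R\<^esub>, \<one>\<^bsub>R\<^esub>), (\<one>\<^bsub>R\<^esub>, \<zero>\<^bsub>R\<^esub>)) \<in> unit_rel R}"

definition C_bar :: "('a, 'm) ring_scheme \<Rightarrow> 'a list set" where
  "C_bar R = words R - A_bar R"

definition words_of_length :: "('a, 'm) ring_scheme \<Rightarrow> nat \<Rightarrow> 'a list set" where
  "words_of_length R l = {w \<in> words R. length w = l}"

definition A_bar_of_length :: "('a, 'm) ring_scheme \<Rightarrow> nat \<Rightarrow> 'a list set" where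
  "A_bar_of_length R l = words_of_length R l \<inter> A_bar R"

definition C_bar_of_length :: "('a, 'm) ring_scheme \<Rightarrow> nat \<Rightarrow> 'a list set" where
  "C_bar_of_length R l = words_of_length R l \<inter> C_bar R"

definition P_of_length :: "('a, 'm) ring_scheme \<Rightarrow> nat \<Rightarrow> 'a list set" where
  "P_of_length R l =
     {w \<in> A_bar_of_length R l. \<forall>h\<in>{1..<l}. take h w \<in> C_bar_of_length R h}"

definition P_set :: "('a, 'm) ring_scheme \<Rightarrow> 'a list set" where
  "P_set R = (\<Union>l. P_of_length R l)"

text \<open>
  With \<open>n = length ds\<close> and indices shifted to start at \<open>0\<close>:
  \<open>w = p\<^sub>0 \<delta>\<^sub>0 p\<^sub>1 \<delta>\<^sub>1 \<dots> p\<^bsub>n-1\<^esub> \<delta>\<^bsub>n-1\<^esub> p\<^sub>n\<close>.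
\<close>

definition is_factorization ::
    "('a, 'm) ring_scheme \<Rightarrow> 'a list \<Rightarrow> 'a list list \<Rightarrow> 'a list \<Rightarrow> bool" where
  "is_factorization R w ps ds \<longleftrightarrow>
     length ps = length ds + 1 \<and> set ps \<subseteq> P_set R \<and> set ds \<subseteq> carrier R \<and>
     w = concat (map (\<lambda>i. ps ! i @ [ds ! i]) [0..<length ds]) @ ps ! length ds"

context cring
begin

lemma SL2_mult_closed:
  assumes "A \<in> carrier (SL2 R)" "B \<in> carrier (SL2 R)"
  shows "A \<otimes>\<^bsub>SL2 R\<^esub> B \<in> carrier (SL2 R)"
proof -
  obtain a b c d where A: "A = ((a, b), (c, d))"
    and cl: "a \<in> carrier R" "b \<in> carrier R" "c \<in> carrier R" "d \<in> carrier R"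
    and det: "a \<otimes> d \<ominus> b \<otimes> c = \<one>"
    using assms(1) by (auto simp: SL2_def)
  obtain a' b' c' d' where B: "B = ((a', b'), (c', d'))"
    and cl': "a' \<in> carrier R" "b' \<in> carrier R" "c' \<in> carrier R" "d' \<in> carrier R"
    and det': "a' \<otimes> d' \<ominus> b' \<otimes> c' = \<one>"
    using assms(2) by (auto simp: SL2_def)
  have "(a \<otimes> a' \<oplus> b \<otimes> c') \<otimes> (c \<otimes> b' \<oplus> d \<otimes> d') \<ominus>
      (a \<otimes> b' \<oplus> b \<otimes> d') \<otimes> (c \<otimes> a' \<oplus> d \<otimes> c') =
      (a \<otimes> d \<ominus> b \<otimes> c) \<otimes> (a' \<otimes> d' \<ominus> b' \<otimes> c')"
    using cl cl' by algebra
  then show ?thesis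
    using cl cl' by (simp add: SL2_def A B det det')
qed

lemma SL2_assoc:
  assumes "A \<in> carrier (SL2 R)" "B \<in> carrier (SL2 R)" "C \<in> carrier (SL2 R)"
  shows "A \<otimes>\<^bsub>SL2 R\<^esub> B \<otimes>\<^bsub>SL2 R\<^esub> C = A \<otimes>\<^bsub>SL2 R\<^esub> (B \<otimes>\<^bsub>SL2 R\<^esub> C)"
  using assms by (auto simp: SL2_def l_distr r_distr m_assoc a_ac)

lemma monoid_SL2: "monoid (SL2 R)"
proof (rule monoidI)
  show "\<one>\<^bsub>SL2 R\<^esub> \<in> carrier (SL2 R)"
    by (simp add: SL2_def minus_eq)
qed (use SL2_mult_closed SL2_assoc in \<open>auto simp: SL2_def\<close>)

lemma word_mat_closed: "w \<in> words R \<Longrightarrow> word_mat R w \<in> carrier (SL2 R)"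
proof (induction w)
  case Nil
  then show ?case
    using monoid.one_closed [OF monoid_SL2] by simp
next
  case (Cons \<alpha> w)
  have "letter_mat R \<alpha> \<in> carrier (SL2 R)"
    using Cons.prems by (simp add: words_def letter_mat_def SL2_def minus_eq)
  then show ?case
    using Cons by (simp add: words_def SL2_mult_closed)
qed

lemma word_mat_append:
  assumes "u \<in> words R" "v \<in> words R"
  shows "word_mat R (u @ v) = word_mat R u \<otimes>\<^bsub>SL2 R\<^esub> word_mat R v"
  using assms(1)
proof (induction u)
  case Nil
  then show ?case
    using word_mat_closed [OF assms(2)] monoid.l_one [OF monoid_SL2] by simp
next
  case (Cons \<alpha> u)
  have "letter_mat R \<alpha> \<in> carrier (SL2 R)"
    using Cons.prems by (simp add: words_def letter_mat_def SL2_def minus_eq)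
  then show ?case
    using Cons word_mat_closed assms(2) by (simp add: words_def SL2_assoc)
qed

lemma equiv_unit_rel: "equiv (nonzero_vecs R) (unit_rel R)"
proof (rule equivI)
  show "unit_rel R \<subseteq> nonzero_vecs R \<times> nonzero_vecs R"
    by (auto simp: unit_rel_def)
  show "refl_on (nonzero_vecs R) (unit_rel R)"
    by (auto simp: refl_on_def unit_rel_def nonzero_vecs_def intro!: bexI [of _ \<one>])
  show "sym (unit_rel R)"
  proof (rule symI)
    fix u v
    assume "(u, v) \<in> unit_rel R"
    then obtain l where l: "l \<in> Units R" "u = (l \<otimes> fst v, l \<otimes> snd v)"
      and uv: "u \<in> nonzero_vecs R" "v \<in> nonzero_vecs R"
      by (auto simp: unit_rel_def)
    have "v = (inv l \<otimes> fst u, inv l \<otimes> snd u)"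
    proof -
      have "inv l \<otimes> (l \<otimes> x) = x" if "x \<in> carrier R" for x
        using l(1) that by (metis Units_closed Units_inv_closed Units_l_inv l_one m_assoc)
      with l(2) uv(2) show ?thesis
        by (auto simp: nonzero_vecs_def)
    qed
    with l uv show "(v, u) \<in> unit_rel R"
      unfolding unit_rel_def by blast
  qed
  show "trans (unit_rel R)"
  proof (rule transI)
    fix u v w
    assume "(u, v) \<in> unit_rel R" "(v, w) \<in> unit_rel R"
    then obtain l m where l: "l \<in> Units R" "u = (l \<otimes> fst v, l \<otimes> snd v)"
      and m: "m \<in> Units R" "v = (m \<otimes> fst w, m \<otimes> snd w)"
      and uw: "u \<in> nonzero_vecs R" "w \<in> nonzero_vecs R"
      by (auto simp: unit_rel_def)
    have "u = ((l \<otimes> m) \<otimes> fst w, (l \<otimes> m) \<otimes> snd w)"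
      using l m uw by (cases w) (simp add: nonzero_vecs_def m_assoc Units_closed)
    with l m uw show "(u, w) \<in> unit_rel R"
      unfolding unit_rel_def by blast
  qed
qed

end

end

(* A word lies in A_bar iff the lower right entry of its matrix vanishes (and 1 is nonzero).
   Hence for u in A_bar, the word u d v lies in A_bar iff v does, whatever the letter d: the
   lower right entry of the product is a unit times that of the matrix of v.  So one peels off
   the shortest prefix lying in A_bar together with the next letter and recurses.  P is the set
   of words of A_bar without proper prefix in A_bar, hence is prefix-free, which forces
   uniqueness. *)

theory Submission
  imports Defs
begin

context cring
begin

text \<open>The word's matrix sends the column (0, 1) to its own second column, with entries
  \<open>b\<close> and \<open>d\<close>. If \<open>d\<close> vanishes, the determinant condition
  reads b(-c) = 1, so \<open>b\<close> is a unit and this column is \<open>b\<close> times (1, 0).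
  Over the zero ring there are no nonzero vectors, which accounts for the conjunct
  \<open>\<one> \<noteq> \<zero>\<close>.\<close>

lemma A_bar_iff:
  "w \<in> A_bar R \<longleftrightarrow> w \<in> words R \<and> \<one> \<noteq> \<zero> \<and> snd (snd (word_mat R w)) = \<zero>"
proof (cases "w \<in> words R")
  case True
  obtain a b c d where M: "word_mat R w = ((a, b), (c, d))"
    and cl: "a \<in> carrier R" "b \<in> carrier R" "c \<in> carrier R" "d \<in> carrier R"
    and det: "a \<otimes> d \<ominus> b \<otimes> c = \<one>"
    using word_mat_closed [OF True] by (auto simp: SL2_def)
  have "b \<in> Units R" if "d = \<zero>"
  proof -
    have "b \<otimes> (\<ominus> c) = a \<otimes> \<zero> \<ominus> b \<otimes> c"
      using cl by algebra
    then have "b \<otimes> (\<ominus> c) = \<one>"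
      using det that by simp
    then show ?thesis
      using cl by (metis Units_one_closed a_inv_closed unit_factor)
  qed
  moreover have "b \<noteq> \<zero>" if "d = \<zero>" "\<one> \<noteq> \<zero>"
    using det that cl by (auto simp: minus_eq)
  ultimately show ?thesis
    using True M cl
    by (auto simp: A_bar_def unit_rel_def nonzero_vecs_def Units_closed)
qed (simp add: A_bar_def)

lemma Nil_notin_A_bar: "[] \<notin> A_bar R"
  by (auto simp: A_bar_iff SL2_def)

text \<open>The bottom row of the matrix of \<open>u\<close> is (c, 0). Multiplying it by the matrix
  of the letter gives (0, c), so the letter drops out, and multiplying by the matrix of
  \<open>v\<close> then leaves \<open>c \<otimes> d\<close> at the lower right. The determinant of
  the matrix of \<open>u\<close> makes \<open>c\<close> a unit.\<close>

lemma A_bar_append_Cons_iff: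
  assumes "u \<in> A_bar R" "\<delta> \<in> carrier R" "v \<in> words R"
  shows "u @ \<delta> # v \<in> A_bar R \<longleftrightarrow> v \<in> A_bar R"
proof -
  have u: "u \<in> words R" "snd (snd (word_mat R u)) = \<zero>" and nontriv: "\<one> \<noteq> \<zero>"
    using assms(1) by (simp_all add: A_bar_iff)
  obtain a b c where U: "word_mat R u = ((a, b), (c, \<zero>))"
    and cl: "a \<in> carrier R" "b \<in> carrier R" "c \<in> carrier R"
    and det: "a \<otimes> \<zero> \<ominus> b \<otimes> c = \<one>"
    using word_mat_closed [OF u(1)] u(2) by (auto simp: SL2_def)
  obtain a' b' c' d where V: "word_mat R v = ((a', b'), (c', d))"
    and cl': "a' \<in> carrier R" "b' \<in> carrier R" "c' \<in> carrier R" "d \<in> carrier R"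
    using word_mat_closed [OF assms(3)] by (auto simp: SL2_def)
  have \<delta>v: "\<delta> # v \<in> words R" and w: "u @ \<delta> # v \<in> words R"
    using assms(2,3) u(1) by (simp_all add: words_def)
  have entry: "snd (snd (word_mat R (u @ \<delta> # v))) = c \<otimes> d"
    using cl cl' assms(2) by (simp add: word_mat_append [OF u(1) \<delta>v] U V SL2_def letter_mat_def)
  have "d = \<zero>" if "c \<otimes> d = \<zero>"
  proof -
    \<comment> \<open>Multiplying by the determinant, which is 1, brings out the factor
      \<open>c \<otimes> d\<close>.\<close>
    have "d = (a \<otimes> \<zero> \<ominus> b \<otimes> c) \<otimes> d"
      using det cl' by simp
    also have "\<dots> = \<ominus> (b \<otimes> (c \<otimes> d))"
      using cl cl' by algebra
    finally show ?thesis
      using that cl by simp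
  qed
  then have "c \<otimes> d = \<zero> \<longleftrightarrow> d = \<zero>"
    using cl by auto
  then show ?thesis
    using w assms(3) nontriv by (simp add: A_bar_iff entry V)
qed

lemma P_set_iff: "p \<in> P_set R \<longleftrightarrow> p \<in> A_bar R \<and> (\<forall>h<length p. take h p \<notin> A_bar R)"
proof -
  have "take h p \<in> words R" if "p \<in> A_bar R" for h
    using that by (auto simp: A_bar_iff words_def dest: in_set_takeD)
  \<comment> \<open>The index 0 may be added because the empty word has the identity matrix, hence
    is not in \<open>A_bar R\<close>.\<close>
  moreover have "(\<forall>h\<in>{1..<length p}. take h p \<notin> A_bar R) \<longleftrightarrow>
      (\<forall>h<length p. take h p \<notin> A_bar R)"
    using Nil_notin_A_bar by (metis One_nat_def Suc_leI atLeastLessThan_iff neq0_conv take0)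
  ultimately show ?thesis
    by (auto simp: P_set_def P_of_length_def A_bar_of_length_def C_bar_of_length_def
        words_of_length_def C_bar_def A_bar_def)
qed

text \<open>Two prefixes of one word are comparable; were their lengths different, the shorter would
  be a proper prefix of the longer lying in \<open>A_bar R\<close>.\<close>

lemma P_set_prefix_free:
  assumes "p \<in> P_set R" "q \<in> P_set R" "p @ s = q @ t"
  shows "p = q"
proof -
  have "\<not> length x < length y"
    if "x \<in> P_set R" "y \<in> P_set R" "x @ s' = y @ t'" for x y s' t'
  proof
    assume "length x < length y"
    moreover from this have "take (length x) y = x"
      using that(3) by (auto simp: append_eq_append_conv2)
    ultimately show False
      using that(1,2) by (metis P_set_iff)
  qed
  from this [OF assms] this [OF assms(2,1) assms(3) [symmetric]] have "length p = length q"
    by simp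
  then show ?thesis
    using assms(3) by simp
qed

lemma is_factorization_Nil_iff:
  "is_factorization R w ps [] \<longleftrightarrow> w \<in> P_set R \<and> ps = [w]"
  by (cases ps) (auto simp: is_factorization_def)

text \<open>Turns the indexed concatenation into a recursion on the list of letters, the form that
  the inductions below use.\<close>

lemma is_factorization_Cons_iff:
  "is_factorization R w ps (\<delta> # ds) \<longleftrightarrow>
    (\<exists>p ps' v. ps = p # ps' \<and> w = p @ \<delta> # v \<and> p \<in> P_set R \<and> \<delta> \<in> carrier R \<and>
      is_factorization R v ps' ds)"
proof (cases ps)
  case (Cons p ps')
  have "map (\<lambda>i. (p # ps') ! i @ [(\<delta> # ds) ! i]) [0..<Suc (length ds)] =
      (p @ [\<delta>]) # map (\<lambda>i. ps' ! i @ [ds ! i]) [0..<length ds]"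
    by (simp add: upt_conv_Cons map_Suc_upt [symmetric] o_def del: upt_Suc)
  then show ?thesis
    unfolding is_factorization_def Cons by auto
qed (simp add: is_factorization_def)

lemma is_factorization_imp_A_bar: "is_factorization R w ps ds \<Longrightarrow> w \<in> A_bar R"
proof (induction ds arbitrary: w ps)
  case Nil
  then show ?case
    by (simp add: is_factorization_Nil_iff P_set_iff)
next
  case (Cons \<delta> ds)
  then show ?case
    using A_bar_append_Cons_iff
    by (fastforce simp: is_factorization_Cons_iff P_set_iff A_bar_iff)
qed

text \<open>Both factorizations begin with a prefix of \<open>w\<close> from \<open>P_set R\<close>,
  so these prefixes agree; then so do the next letters and the remainders, to which induction
  applies.\<close>

lemma is_factorization_unique:
  "is_factorization R w ps ds \<Longrightarrow> is_factorization R w ps' ds' \<Longrightarrow> ps = ps' \<and> ds = ds'"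
proof (induction ds arbitrary: w ps ps' ds')
  case Nil
  then have w: "w \<in> P_set R" "ps = [w]"
    by (simp_all add: is_factorization_Nil_iff)
  show ?case
  proof (cases ds')
    case Nil
    then show ?thesis
      using Nil.prems w by (simp add: is_factorization_Nil_iff)
  next
    case (Cons \<delta>' es)
    then obtain p' v' where "w = p' @ \<delta>' # v'" "p' \<in> P_set R"
      using Nil.prems(2) by (auto simp: is_factorization_Cons_iff)
    \<comment> \<open>Here \<open>w\<close> itself would equal its prefix \<open>p'\<close>, which
      lacks at least the letter \<open>\<delta>'\<close>.\<close>
    with w(1) P_set_prefix_free [of w p' "[]" "\<delta>' # v'"] show ?thesis
      by simp
  qed
next
  case (Cons \<delta> ds)
  then obtain p qs v where w: "ps = p # qs" "w = p @ \<delta> # v" "p \<in> P_set R"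
    and v: "is_factorization R v qs ds"
    by (auto simp: is_factorization_Cons_iff)
  show ?case
  proof (cases ds')
    case Nil
    then have "w \<in> P_set R"
      using Cons.prems(2) by (simp add: is_factorization_Nil_iff)
    then have "p = w"
      by (rule P_set_prefix_free [OF w(3), of _ "\<delta> # v" "[]"]) (simp add: w(2))
    with w(2) have False
      by simp
    then show ?thesis ..
  next
    case (Cons \<delta>' es)
    then obtain p' qs' v' where w': "ps' = p' # qs'" "w = p' @ \<delta>' # v'" "p' \<in> P_set R"
      and v': "is_factorization R v' qs' es"
      using Cons.prems(2) by (auto simp: is_factorization_Cons_iff)
    have "p = p'"
      by (rule P_set_prefix_free [OF w(3) w'(3)]) (use w(2) w'(2) in \<open>rule trans [OF sym]\<close>)
    with w(2) w'(2) have "\<delta> = \<delta>'" "v = v'"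
      by simp_all
    with Cons.IH [OF v] v' \<open>p = p'\<close> w(1) w'(1) Cons show ?thesis
      by simp
  qed
qed

lemma A_bar_obtains_P_set_prefix:
  assumes "w \<in> A_bar R"
  obtains p s where "w = p @ s" "p \<in> P_set R"
proof
  define h where "h = (LEAST h. take h w \<in> A_bar R)"
  have ex: "take (length w) w \<in> A_bar R"
    using assms by simp
  have "take h w \<in> A_bar R"
    unfolding h_def by (rule LeastI [of _ "length w"]) (rule ex)
  moreover have "h \<le> length w"
    unfolding h_def by (rule Least_le) (rule ex)
  moreover have "take k w \<notin> A_bar R" if "k < h" for k
    using not_less_Least that unfolding h_def by blast
  \<comment> \<open>For \<open>k < h\<close> the prefix of length \<open>k\<close> of
    \<open>take h w\<close> is \<open>take k w\<close>, so minimality of \<open>h\<close>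
    applies.\<close>
  ultimately show "take h w \<in> P_set R"
    by (auto simp: P_set_iff min_def)
  show "w = take h w @ drop h w"
    by simp
qed

text \<open>If the prefix \<open>p\<close> is all of \<open>w\<close>, there are no letters
  \<delta>. Otherwise the rest after \<open>p\<close> and one letter is a shorter word, again in
  \<open>A_bar R\<close>.\<close>

lemma A_bar_imp_is_factorization:
  "w \<in> A_bar R \<Longrightarrow> \<exists>ps ds. is_factorization R w ps ds"
proof (induction w rule: length_induct)
  case (1 w)
  obtain p s where w: "w = p @ s" and p: "p \<in> P_set R"
    using A_bar_obtains_P_set_prefix [OF 1(2)] .
  show ?case
  proof (cases s)
    case Nil
    then show ?thesis
      using w p is_factorization_Nil_iff by auto
  next
    case (Cons \<delta> v)
    have \<delta>v: "\<delta> \<in> carrier R" "v \<in> words R"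
      using 1(2) by (simp_all add: A_bar_iff words_def w Cons)
    then have "v \<in> A_bar R"
      using A_bar_append_Cons_iff [of p \<delta> v] 1(2) p by (simp add: w Cons P_set_iff)
    then obtain ps ds where "is_factorization R v ps ds"
      using 1(1) [rule_format, of v] by (auto simp: w Cons)
    then have "is_factorization R w (p # ps) (\<delta> # ds)"
      using w p \<delta>v Cons by (auto simp: is_factorization_Cons_iff)
    then show ?thesis
      by blast
  qed
qed

end

theorem theorem5p2:
  fixes N :: nat and w :: "int set list"
  assumes "N > 0" and "w \<in> words (ZFact (int N))"
  shows "(w \<in> A_bar (ZFact (int N)) \<longleftrightarrow> (\<exists>ps ds. is_factorization (ZFact (int N)) w ps ds)) \<and>
    (w \<in> A_bar (ZFact (int N)) \<longrightarrow>
      (\<exists>!(ps, ds). is_factorization (ZFact (int N)) w ps ds))"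
proof -
  interpret cring "ZFact (int N)"
    by (rule ZFact_is_cring)
  have iff: "w \<in> A_bar (ZFact (int N)) \<longleftrightarrow> (\<exists>ps ds. is_factorization (ZFact (int N)) w ps ds)"
    using A_bar_imp_is_factorization is_factorization_imp_A_bar by blast
  \<comment> \<open>Starting from a given factorization supplies the witness; \<open>iff\<close>
    provides one for each \<open>w\<close> in \<open>A_bar\<close>.\<close>
  moreover have "\<exists>!(ps, ds). is_factorization (ZFact (int N)) w ps ds"
    if "is_factorization (ZFact (int N)) w ps ds" for ps ds
  proof (rule ex1I [of _ "(ps, ds)"])
    show "case (ps, ds) of (ps, ds) \<Rightarrow> is_factorization (ZFact (int N)) w ps ds"
      using that by simp
    show "x = (ps, ds)" if "case x of (ps, ds) \<Rightarrow> is_factorization (ZFact (int N)) w ps ds" for x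
      using that is_factorization_unique [OF \<open>is_factorization (ZFact (int N)) w ps ds\<close>]
      by (cases x) blast
  qed
  ultimately show ?thesis
    by blast
qed

end
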